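(* Let $n\ge 2$ and let $p(x)=x^n+a_{n-1}x^{n-1}+\dots+a_1x+a_0$ be a monic polynomial with complex coefficients and $a_0\neq 0$. Let $\lambda_1,\dots,\lambda_n$ be its complex roots, listed with multiplicity so that $|\lambda_1|\le|\lambda_2|\le\dots\le|\lambda_n|$. Let $C_1$ be the companion matrix of $p$ and $C_2$ the companion matrix of the monic reversal polynomial $q$ of $p$. Let $N_1$ and $N_2$ be any two (submultiplicative, not necessarily distinct) matrix norms on the $n\times n$ complex matrices. Then the following hold. 1. If $\lambda_1$ and $\lambda_n$ lie on the same ray extending from the origin in the complex plane, then for all positive integers $k_1,k_2$, $$|\lambda_n-\lambda_1|\le N_1\left(C_1^{k_1}\right)^{1/k_1}-N_2\left(C_2^{k_2}\right)^{-1/k_2}.$$ 2. If $\lambda_1,\lambda_n$ and $0$ are collinear, but $\lambda_1$ and $\lambda_n$ lie on opposite rays extending from the origin, then for every $\varepsilon>0$ there exists a positive integer $k_0$ such that for every integer $k>k_0$, $$|\lambda_n-\lambda_1|> N_1\left(C_1^{k}\right)^{1/k}+N_2\left(C_2^{k}\right)^{-1/k}-\varepsilon.$$ 3. If $\lambda_1,\lambda_n$ and $0$ are not collinear, then there exist positive numbers $\gamma_1$ and $\gamma_2$ such that for every $\varepsilon_1\in[0,\gamma_1)$ and every $\varepsilon_2\in[0,\gamma_2)$ there exists an integer $k_0$ such that for every integer $k>k_0$, $$N_1\left(C_1^{k}\right)^{1/k}-N_2\left(C_2^{k}\right)^{-1/k}+\varepsilon_1<|\lambda_n-\lambda_1|<N_1\left(C_1^{k}\right)^{1/k}+N_2\left(C_2^{k}\right)^{-1/k}-\varepsilon_2.$$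 4. Assertions 1, 2 and 3 remain valid if, instead, $C_1$ is any nonsingular $n\times n$ complex matrix with $n\ge2$, whose eigenvalues listed with algebraic multiplicity are $\lambda_1,\dots,\lambda_n$ with $|\lambda_1|\le\dots\le|\lambda_n|$, and $C_2$ is the inverse of $C_1$ or any other square complex matrix whose largest and smallest eigenvalues in absolute value are, respectively, $1/\lambda_1$ and $1/\lambda_n$ (with $N_2$ a matrix norm on the complex matrices of the size of $C_2$).
   Context: A matrix norm is a norm $N$ on a space of square complex matrices of a given size which is submultiplicative: $N(AB)\le N(A)N(B)$. For a monic polynomial $f(x)=x^n+c_{n-1}x^{n-1}+\dots+c_0$, the companion matrix of $f$ is the $n\times n$ matrix with $1$'s on the first subdiagonal, last column $(-c_0,-c_1,\dots,-c_{n-1})^{T}$, and all other entries $0$. For $p(x)=x^n+a_{n-1}x^{n-1}+\dots+a_0$ with $a_0\ne0$, the monic reversal polynomial of $p$ is $q(x)=x^n+\frac{a_1}{a_0}x^{n-1}+\dots+\frac{a_{n-1}}{a_0}x+\frac{1}{a_0}$. *)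

theory Defs
  imports "HOL-Analysis.Linear_Algebra" "Jordan_Normal_Form.Spectral_Radius"
begin

definition matrix_norm :: "nat \<Rightarrow> (complex mat \<Rightarrow> real) \<Rightarrow> bool" where
  "matrix_norm n N \<longleftrightarrow>
     (\<forall>A\<in>carrier_mat n n. 0 \<le> N A \<and> (N A = 0 \<longleftrightarrow> A = 0\<^sub>m n n)) \<and>
     (\<forall>c. \<forall>A\<in>carrier_mat n n. N (c \<cdot>\<^sub>m A) = cmod c * N A) \<and>
     (\<forall>A\<in>carrier_mat n n. \<forall>B\<in>carrier_mat n n. N (A + B) \<le> N A + N B) \<and>
     (\<forall>A\<in>carrier_mat n n. \<forall>B\<in>carrier_mat n n. N (A * B) \<le> N A * N B)"

text \<open>Rows and columns are numbered from 0. The definition is meant for monic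
  polynomials; the leading coefficient is not used.\<close>

definition companion_mat :: "complex poly \<Rightarrow> complex mat" where
  "companion_mat f = mat (degree f) (degree f)
     (\<lambda>(i, j). if j = degree f - 1 then - coeff f i else if i = j + 1 then 1 else 0)"

text \<open>\<^const>\<open>reflect_poly\<close> reverses the list of coefficients, so it keeps the degree
  only when the constant coefficient is nonzero.\<close>

definition monic_reversal :: "complex poly \<Rightarrow> complex poly" where
  "monic_reversal p = Polynomial.smult (1 / coeff p 0) (reflect_poly p)"

lemma coeff_monic_reversal:
  assumes "k \<le> degree p"
  shows "coeff (monic_reversal p) k = coeff p (degree p - k) / coeff p 0"
  using assms by (simp add: monic_reversal_def coeff_reflect_poly)

lemma degree_monic_reversal:
  assumes "coeff p 0 \<noteq> 0"
  shows "degree (monic_reversal p) = degree p"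
  using assms by (simp add: monic_reversal_def)

definition ray :: "complex \<Rightarrow> complex set" where
  "ray u = {t *\<^sub>R u | t. 0 \<le> t}"

definition on_same_ray :: "complex \<Rightarrow> complex \<Rightarrow> bool" where
  "on_same_ray a b \<longleftrightarrow> (\<exists>u. u \<noteq> 0 \<and> a \<in> ray u \<and> b \<in> ray u)"

definition on_opposite_rays :: "complex \<Rightarrow> complex \<Rightarrow> bool" where
  "on_opposite_rays a b \<longleftrightarrow> (\<exists>u. u \<noteq> 0 \<and> a \<in> ray u \<and> b \<in> ray (- u))"

definition modulus_ordered :: "nat \<Rightarrow> (nat \<Rightarrow> complex) \<Rightarrow> bool" where
  "modulus_ordered n l \<longleftrightarrow> (\<forall>i\<in>{1..n}. \<forall>j\<in>{1..n}. i \<le> j \<longrightarrow> cmod (l i) \<le> cmod (l j))"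

definition ordered_roots :: "complex poly \<Rightarrow> nat \<Rightarrow> (nat \<Rightarrow> complex) \<Rightarrow> bool" where
  "ordered_roots p n l \<longleftrightarrow>
     image_mset l (mset_set {1..n}) = proots p \<and> modulus_ordered n l"

definition largest_eigenvalue :: "complex mat \<Rightarrow> complex \<Rightarrow> bool" where
  "largest_eigenvalue A \<mu> \<longleftrightarrow>
     eigenvalue A \<mu> \<and> (\<forall>\<nu>. eigenvalue A \<nu> \<longrightarrow> cmod \<nu> \<le> cmod \<mu>)"

definition smallest_eigenvalue :: "complex mat \<Rightarrow> complex \<Rightarrow> bool" where
  "smallest_eigenvalue A \<mu> \<longleftrightarrow>
     eigenvalue A \<mu> \<and> (\<forall>\<nu>. eigenvalue A \<nu> \<longrightarrow> cmod \<mu> \<le> cmod \<nu>)"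

text \<open>The three assertions, in terms of the numbers \<open>a\<close> and \<open>b\<close> of smallest and largest
  modulus.\<close>

definition same_ray_bound ::
    "(complex mat \<Rightarrow> real) \<Rightarrow> complex mat \<Rightarrow> (complex mat \<Rightarrow> real) \<Rightarrow> complex mat \<Rightarrow>
     complex \<Rightarrow> complex \<Rightarrow> bool" where
  "same_ray_bound N1 C1 N2 C2 a b \<longleftrightarrow>
     (on_same_ray a b \<longrightarrow>
       (\<forall>k1>0. \<forall>k2>0.
          cmod (b - a) \<le> N1 (C1 ^\<^sub>m k1) powr (1 / real k1) - N2 (C2 ^\<^sub>m k2) powr (- 1 / real k2)))"

definition opposite_rays_bound ::
    "(complex mat \<Rightarrow> real) \<Rightarrow> complex mat \<Rightarrow> (complex mat \<Rightarrow> real) \<Rightarrow> complex mat \<Rightarrow>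
     complex \<Rightarrow> complex \<Rightarrow> bool" where
  "opposite_rays_bound N1 C1 N2 C2 a b \<longleftrightarrow>
     (collinear {a, b, 0} \<and> on_opposite_rays a b \<longrightarrow>
       (\<forall>\<epsilon>>0. \<exists>k0>0. \<forall>k>k0.
          cmod (b - a) > N1 (C1 ^\<^sub>m k) powr (1 / real k) + N2 (C2 ^\<^sub>m k) powr (- 1 / real k) - \<epsilon>))"

definition noncollinear_bounds ::
    "(complex mat \<Rightarrow> real) \<Rightarrow> complex mat \<Rightarrow> (complex mat \<Rightarrow> real) \<Rightarrow> complex mat \<Rightarrow>
     complex \<Rightarrow> complex \<Rightarrow> bool" where
  "noncollinear_bounds N1 C1 N2 C2 a b \<longleftrightarrow>
     (\<not> collinear {a, b, 0} \<longrightarrow>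
       (\<exists>\<gamma>1>0. \<exists>\<gamma>2>0. \<forall>\<epsilon>1\<in>{0..<\<gamma>1}. \<forall>\<epsilon>2\<in>{0..<\<gamma>2}. \<exists>k0. \<forall>k>k0.
          N1 (C1 ^\<^sub>m k) powr (1 / real k) - N2 (C2 ^\<^sub>m k) powr (- 1 / real k) + \<epsilon>1 < cmod (b - a) \<and>
          cmod (b - a) < N1 (C1 ^\<^sub>m k) powr (1 / real k) + N2 (C2 ^\<^sub>m k) powr (- 1 / real k) - \<epsilon>2))"

end

theory Submission
  imports Defs "HOL-Real_Asymp.Real_Asymp"
begin

text \<open>If \<open>A v = \<mu> v\<close>, then the square matrix \<open>V\<close> with all columns equal to \<open>v\<close> satisfies
  \<open>A ^ k V = \<mu> ^ k V\<close>, so submultiplicativity gives \<open>|\<mu>| ^ k \<le> N (A ^ k)\<close> for every matrix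
  norm. For \<open>\<mu>\<close> of largest modulus, the entries of \<open>(A / |\<mu>|) ^ k\<close> grow at most polynomially
  in \<open>k\<close>, hence \<open>N (A ^ k) powr (1 / k)\<close> tends to \<open>|\<mu>|\<close> from above. Applied to \<open>C1\<close> and \<open>C2\<close>,
  this traps \<open>|b|\<close> and \<open>|a|\<close>, and the three assertions reduce to comparing \<open>|b - a|\<close> with
  \<open>|b| - |a|\<close> and \<open>|b| + |a|\<close>, which are strict bounds unless \<open>a\<close>, \<open>b\<close>, \<open>0\<close> are collinear.\<close>

section \<open>Matrix norms and entrywise bounds\<close>

lemma matrix_normD:
  assumes "matrix_norm n N" and "A \<in> carrier_mat n n"
  shows "0 \<le> N A"
    and "N A = 0 \<longleftrightarrow> A = 0\<^sub>m n n"
    and "N (c \<cdot>\<^sub>m A) = cmod c * N A"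
    and "B \<in> carrier_mat n n \<Longrightarrow> N (A + B) \<le> N A + N B"
    and "B \<in> carrier_mat n n \<Longrightarrow> N (A * B) \<le> N A * N B"
  using assms by (auto simp: matrix_norm_def)

text \<open>Expanding a matrix in matrix units and applying the triangle inequality bounds any norm
  by the largest entry; \<open>K\<close> is the sum of the norms of the units. This carries
  entrywise growth estimates over to an arbitrary \<open>N\<close>.\<close>

lemma matrix_norm_le_norm_bound:
  assumes N: "matrix_norm n N"
  obtains K where "0 \<le> K"
    and "\<And>A b. A \<in> carrier_mat n n \<Longrightarrow> norm_bound A b \<Longrightarrow> N A \<le> K * b"
proof -
  \<comment> \<open>\<open>E p\<close> is the matrix unit at position \<open>p\<close>.
    \<open>R A S\<close> keeps only the entries of \<open>A\<close> in \<open>S\<close>, so that the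
    triangle inequality can be applied one entry at a time.\<close>
  define E :: "nat \<times> nat \<Rightarrow> complex mat" where "E p = mat n n (\<lambda>q. if q = p then 1 else 0)" for p
  define R :: "complex mat \<Rightarrow> (nat \<times> nat) set \<Rightarrow> complex mat"
    where "R A S = mat n n (\<lambda>q. if q \<in> S then A $$ q else 0)" for A S
  let ?I = "{..<n} \<times> {..<n}"
  have E: "E p \<in> carrier_mat n n" for p by (simp add: E_def)
  have R: "R A S \<in> carrier_mat n n" for A S by (simp add: R_def)
  have R_le: "N (R A S) \<le> (\<Sum>p\<in>S. cmod (A $$ p) * N (E p))" if "finite S" for A S
    using that
  proof (induction S rule: finite_induct)
    case empty
    have "R A {} = 0\<^sub>m n n" by (rule eq_matI) (auto simp: R_def)
    then show ?case using matrix_normD(2)[OF N R, of A "{}"] by simp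
  next
    case (insert p S)
    have "R A (insert p S) = R A S + A $$ p \<cdot>\<^sub>m E p"
      using insert.hyps by (intro eq_matI) (auto simp: R_def E_def)
    then have "N (R A (insert p S)) \<le> N (R A S) + N (A $$ p \<cdot>\<^sub>m E p)"
      using matrix_normD(4)[OF N R] E by simp
    then show ?case
      using insert matrix_normD(3)[OF N E] by simp
  qed
  show thesis
  proof
    show "0 \<le> (\<Sum>p\<in>?I. N (E p))"
      using matrix_normD(1)[OF N E] by (simp add: sum_nonneg)
  next
    fix A :: "complex mat" and b assume A: "A \<in> carrier_mat n n" and b: "norm_bound A b"
    have "N A = N (R A ?I)"
      using A by (intro arg_cong[of _ _ N] eq_matI) (auto simp: R_def)
    also have "\<dots> \<le> (\<Sum>p\<in>?I. cmod (A $$ p) * N (E p))"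
      by (rule R_le) simp
    also have "\<dots> \<le> (\<Sum>p\<in>?I. b * N (E p))"
      using A b matrix_normD(1)[OF N E]
      by (intro sum_mono mult_right_mono) (auto simp: norm_bound_def)
    finally show "N A \<le> (\<Sum>p\<in>?I. N (E p)) * b"
      by (simp add: sum_distrib_left mult.commute)
  qed
qed

section \<open>Lower bounds from eigenvalues\<close>

text \<open>\<open>N\<close> measures matrices rather than vectors, so the eigenvector is repeated
  into a nonzero square matrix \<open>V\<close>, whose norm cancels.\<close>

lemma eigenvalue_power_le_matrix_norm:
  assumes N: "matrix_norm n N" and A: "A \<in> carrier_mat n n" and "eigenvalue A \<mu>"
  shows "cmod \<mu> ^ k \<le> N (A ^\<^sub>m k)"
proof -
  obtain v where v: "eigenvector A v \<mu>"
    using \<open>eigenvalue A \<mu>\<close> by (auto simp: eigenvalue_def)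
  then have v_carrier: "v \<in> carrier_vec n" and v_nz: "v \<noteq> 0\<^sub>v n"
    using A by (auto simp: eigenvector_def)
  define V where "V = mat n n (\<lambda>(i, j). v $ i)"
  have V: "V \<in> carrier_mat n n" by (simp add: V_def)
  have Ak: "A ^\<^sub>m k \<in> carrier_mat n n" using A by simp
  have col_V: "col V j = v" if "j < n" for j
    using that v_carrier by (intro eq_vecI) (auto simp: V_def)
  have "A ^\<^sub>m k * V = \<mu> ^ k \<cdot>\<^sub>m V"
  proof (rule eq_matI)
    fix i j assume "i < dim_row (\<mu> ^ k \<cdot>\<^sub>m V)" and "j < dim_col (\<mu> ^ k \<cdot>\<^sub>m V)"
    then have ij: "i < n" "j < n" by (simp_all add: V_def)
    have "(A ^\<^sub>m k * V) $$ (i, j) = (A ^\<^sub>m k *\<^sub>v v) $ i"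
      using ij Ak V col_V[OF ij(2)] by (simp del: pow_mat_dim pow_mat_dim_square)
    also have "\<dots> = (\<mu> ^ k \<cdot>\<^sub>v v) $ i"
      using eigenvector_pow[OF A v] by simp
    finally show "(A ^\<^sub>m k * V) $$ (i, j) = (\<mu> ^ k \<cdot>\<^sub>m V) $$ (i, j)"
      using ij v_carrier by (simp add: V_def)
  qed (use Ak V in auto)
  then have le: "cmod \<mu> ^ k * N V \<le> N (A ^\<^sub>m k) * N V"
    using matrix_normD(5)[OF N Ak V] matrix_normD(3)[OF N V] by (simp add: norm_power)
  have "V \<noteq> 0\<^sub>m n n"
  proof
    assume V0: "V = 0\<^sub>m n n"
    have "v = 0\<^sub>v n"
    proof (rule eq_vecI)
      fix i assume "i < dim_vec (0\<^sub>v n :: complex vec)"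
      then have i: "i < n" by simp
      then have "v $ i = V $$ (i, i)" by (simp add: V_def)
      then show "v $ i = 0\<^sub>v n $ i" using i V0 by simp
    qed (use v_carrier in simp)
    with v_nz show False by simp
  qed
  then have "0 < N V" using matrix_normD(1,2)[OF N V] by linarith
  with le show ?thesis by simp
qed

text \<open>The bound holds for each positive exponent and not only in the limit, which is why
  assertion 1 can allow unrelated \<open>k1\<close> and \<open>k2\<close>.\<close>

lemma eigenvalue_norm_le_root_matrix_norm:
  assumes "matrix_norm n N" "A \<in> carrier_mat n n" "eigenvalue A \<mu>" "\<mu> \<noteq> 0" "0 < k"
  shows "cmod \<mu> \<le> N (A ^\<^sub>m k) powr (1 / real k)"
proof -
  have "cmod \<mu> = (cmod \<mu> ^ k) powr (1 / real k)"
    using assms by (simp flip: powr_realpow add: powr_powr)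
  also have "\<dots> \<le> N (A ^\<^sub>m k) powr (1 / real k)"
    using eigenvalue_power_le_matrix_norm[OF assms(1-3)] by (intro powr_mono2) auto
  finally show ?thesis .
qed

section \<open>Growth of powers and the limit of the roots\<close>

lemma eigenvalue_smult_mat:
  assumes A: "A \<in> carrier_mat n n" and "eigenvalue A \<mu>"
  shows "eigenvalue (c \<cdot>\<^sub>m A) (c * \<mu>)"
proof -
  obtain v where v: "v \<in> carrier_vec n" "v \<noteq> 0\<^sub>v n" "A *\<^sub>v v = \<mu> \<cdot>\<^sub>v v"
    using assms by (auto simp: eigenvalue_def eigenvector_def)
  have "(c \<cdot>\<^sub>m A) *\<^sub>v v = c \<cdot>\<^sub>v (A *\<^sub>v v)"
    using A v(1) by (intro eq_vecI) auto
  then show ?thesis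
    using A v by (auto simp: eigenvalue_def eigenvector_def smult_smult_assoc)
qed

lemma pow_smult_mat:
  fixes A :: "'a :: comm_ring_1 mat"
  assumes A: "A \<in> carrier_mat n n"
  shows "(c \<cdot>\<^sub>m A) ^\<^sub>m k = c ^ k \<cdot>\<^sub>m A ^\<^sub>m k"
proof (induction k)
  case 0
  show ?case using A by (intro eq_matI) auto
next
  case (Suc k)
  have Ak: "A ^\<^sub>m k \<in> carrier_mat n n" using A by simp
  have "(c \<cdot>\<^sub>m A) ^\<^sub>m Suc k = c ^ k \<cdot>\<^sub>m A ^\<^sub>m k * (c \<cdot>\<^sub>m A)"
    by (simp add: Suc)
  also have "\<dots> = c ^ k \<cdot>\<^sub>m (c \<cdot>\<^sub>m (A ^\<^sub>m k * A))"
    using A Ak mult_smult_assoc_mat[OF Ak, of "c \<cdot>\<^sub>m A" n "c ^ k"] mult_smult_distrib[OF Ak A] by simp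
  also have "\<dots> = c ^ Suc k \<cdot>\<^sub>m A ^\<^sub>m Suc k"
    using A by (intro eq_matI) (auto simp: mult_ac)
  finally show ?case .
qed

text \<open>Scaling by \<open>1 / cmod \<mu>\<close> brings the spectral radius to at most 1, where
  the Jordan normal form gives polynomial growth of the entries. The factor
  \<open>real (Suc k) ^ n\<close> is at least 1 for every \<open>k\<close>, so a single constant
  absorbs all terms.\<close>

lemma matrix_norm_power_le:
  assumes N: "matrix_norm n N" and A: "A \<in> carrier_mat n n"
    and \<mu>: "largest_eigenvalue A \<mu>" and "\<mu> \<noteq> 0"
  obtains D where "0 < D" and "\<And>k. N (A ^\<^sub>m k) \<le> cmod \<mu> ^ k * (D * real (Suc k) ^ n)"
proof -
  have n: "0 < n"
    using \<mu> eigenvalue_imp_nonzero_dim[OF A] by (auto simp: largest_eigenvalue_def)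
  define r where "r = cmod \<mu>"
  have r: "0 < r" using \<open>\<mu> \<noteq> 0\<close> by (simp add: r_def)
  define B where "B = complex_of_real (1 / r) \<cdot>\<^sub>m A"
  have B: "B \<in> carrier_mat n n" using A by (simp add: B_def)
  have A_eq: "A = complex_of_real r \<cdot>\<^sub>m B"
    using r by (intro eq_matI) (auto simp: B_def)
  have "cmod \<nu> \<le> 1" if "eigenvalue B \<nu>" for \<nu>
  proof -
    have "eigenvalue A (complex_of_real r * \<nu>)"
      using eigenvalue_smult_mat[OF B that] A_eq by metis
    then have "r * cmod \<nu> \<le> r"
      using \<mu> r by (auto simp: largest_eigenvalue_def r_def norm_mult)
    then show ?thesis using r by simp
  qed
  then have "spectral_radius B \<le> 1"
    using spectral_radius_mem_max(1)[OF B n] by (auto simp: spectrum_def)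
  then obtain c1 c2 where c: "norm_bound (B ^\<^sub>m k) (c1 + c2 * real k ^ (n - 1))" for k
    using spectral_radius_jnf_norm_bound_le_1_upper_triangular[OF B] by auto
  obtain K where K: "0 \<le> K"
    and K_le: "\<And>A b. A \<in> carrier_mat n n \<Longrightarrow> norm_bound A b \<Longrightarrow> N A \<le> K * b"
    using matrix_norm_le_norm_bound[OF N] by blast
  show thesis
  proof
    \<comment> \<open>\<open>K\<close> passes from entries to \<open>N\<close>, the absolute values
      cover unknown signs of \<open>c1\<close> and \<open>c2\<close>, and the added 1 forces
      positivity, so that the \<open>k\<close>-th root of the constant tends to 1.\<close>
    show "0 < K * (\<bar>c1\<bar> + \<bar>c2\<bar>) + 1" using K by (simp add: add_nonneg_pos)
  next
    fix k
    let ?s = "real (Suc k)"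
    have Bk: "B ^\<^sub>m k \<in> carrier_mat n n" using B by simp
    have s: "1 \<le> ?s ^ n" by (rule one_le_power) simp
    have "real k ^ (n - 1) \<le> ?s ^ (n - 1)" by (rule power_mono) auto
    also have "\<dots> \<le> ?s ^ n" by (rule power_increasing) auto
    finally have "c2 * real k ^ (n - 1) \<le> \<bar>c2\<bar> * ?s ^ n"
      by (intro mult_mono) auto
    moreover have "c1 \<le> \<bar>c1\<bar> * ?s ^ n"
      using mult_left_mono[OF s, of "\<bar>c1\<bar>"] by simp
    ultimately have "c1 + c2 * real k ^ (n - 1) \<le> (\<bar>c1\<bar> + \<bar>c2\<bar>) * ?s ^ n"
      unfolding distrib_right by linarith
    then have "K * (c1 + c2 * real k ^ (n - 1)) \<le> K * ((\<bar>c1\<bar> + \<bar>c2\<bar>) * ?s ^ n)"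
      using K by (rule mult_left_mono)
    then have "N (B ^\<^sub>m k) \<le> (K * (\<bar>c1\<bar> + \<bar>c2\<bar>) + 1) * ?s ^ n"
      using K_le[OF Bk c] s unfolding distrib_right mult.assoc by linarith
    moreover have "N (A ^\<^sub>m k) = r ^ k * N (B ^\<^sub>m k)"
      using matrix_normD(3)[OF N Bk] r
      by (subst A_eq) (simp add: pow_smult_mat[OF B] norm_power)
    ultimately show "N (A ^\<^sub>m k) \<le> cmod \<mu> ^ k * ((K * (\<bar>c1\<bar> + \<bar>c2\<bar>) + 1) * ?s ^ n)"
      using r by (simp add: r_def del: of_nat_Suc)
  qed
qed

text \<open>Gelfand's formula for an arbitrary matrix norm: the roots lie between
  \<open>cmod \<mu>\<close> and \<open>cmod \<mu>\<close> times the \<open>k\<close>-th root of a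
  polynomial in \<open>k\<close>, which tends to 1.\<close>

lemma root_matrix_norm_tendsto:
  assumes N: "matrix_norm n N" and A: "A \<in> carrier_mat n n"
    and \<mu>: "largest_eigenvalue A \<mu>" and nz: "\<mu> \<noteq> 0"
  shows "(\<lambda>k. N (A ^\<^sub>m k) powr (1 / real k)) \<longlonglongrightarrow> cmod \<mu>"
proof -
  obtain D where D: "0 < D"
    and le: "\<And>k. N (A ^\<^sub>m k) \<le> cmod \<mu> ^ k * (D * real (Suc k) ^ n)"
    using matrix_norm_power_le[OF assms] by blast
  have ev: "eigenvalue A \<mu>" using \<mu> by (simp add: largest_eigenvalue_def)
  let ?u = "\<lambda>k. cmod \<mu> * (D powr (1 / real k) * (real (Suc k) powr (1 / real k)) ^ n)"
  have "(\<lambda>k. D powr (1 / real k)) \<longlonglongrightarrow> 1"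
    using D by real_asymp
  moreover have "(\<lambda>k. real (Suc k) powr (1 / real k)) \<longlonglongrightarrow> 1"
    by real_asymp
  ultimately have "?u \<longlonglongrightarrow> cmod \<mu> * (1 * 1 ^ n)"
    by (intro tendsto_intros)
  then have upper: "?u \<longlonglongrightarrow> cmod \<mu>" by simp
  have root_le: "N (A ^\<^sub>m k) powr (1 / real k) \<le> ?u k" if k: "0 < k" for k
  proof -
    have "N (A ^\<^sub>m k) powr (1 / real k) \<le> (cmod \<mu> ^ k * (D * real (Suc k) ^ n)) powr (1 / real k)"
      using le matrix_normD(1)[OF N] A by (intro powr_mono2) auto
    also have "\<dots> = (cmod \<mu> powr real k) powr (1 / real k) *
        (D powr (1 / real k) * (real (Suc k) powr real n) powr (1 / real k))"
      using D nz by (simp add: powr_mult powr_realpow del: of_nat_Suc)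
    also have "(real (Suc k) powr real n) powr (1 / real k) = (real (Suc k) powr (1 / real k)) ^ n"
      by (simp add: powr_powr mult.commute flip: powr_realpow)
    also have "(cmod \<mu> powr real k) powr (1 / real k) = cmod \<mu>"
      using k nz by (simp add: powr_powr)
    finally show ?thesis .
  qed
  show ?thesis
  proof (rule tendsto_sandwich[OF _ _ tendsto_const upper])
    \<comment> \<open>At \<open>k = 0\<close> the exponent \<open>1 / real k\<close> is 0 by
      convention, so both bounds are claimed only for positive \<open>k\<close>.\<close>
    show "\<forall>\<^sub>F k in sequentially. cmod \<mu> \<le> N (A ^\<^sub>m k) powr (1 / real k)"
      using eventually_gt_at_top[of 0]
      by eventually_elim (rule eigenvalue_norm_le_root_matrix_norm[OF N A ev nz])
    show "\<forall>\<^sub>F k in sequentially. N (A ^\<^sub>m k) powr (1 / real k) \<le> ?u k"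
      using eventually_gt_at_top[of 0] by eventually_elim (rule root_le)
  qed
qed

section \<open>The distance between \<open>a\<close> and \<open>b\<close> in the plane\<close>

lemma norm_diff_same_ray:
  assumes "on_same_ray a b" "cmod a \<le> cmod b"
  shows "cmod (b - a) = cmod b - cmod a"
proof -
  obtain u s t where *: "u \<noteq> 0" "a = s *\<^sub>R u" "b = t *\<^sub>R u" "0 \<le> s" "0 \<le> t"
    using assms(1) by (auto simp: on_same_ray_def ray_def)
  then have "s \<le> t" using assms(2) by simp
  then show ?thesis
    using * by (simp add: left_diff_distrib flip: scaleR_left_diff_distrib)
qed

lemma norm_diff_opposite_rays:
  assumes "on_opposite_rays a b"
  shows "cmod (b - a) = cmod b + cmod a"
proof -
  obtain u s t where *: "u \<noteq> 0" "a = s *\<^sub>R u" "b = t *\<^sub>R (- u)" "0 \<le> s" "0 \<le> t"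
    using assms by (auto simp: on_opposite_rays_def ray_def)
  then have "b - a = (- (s + t)) *\<^sub>R u" by (simp add: scaleR_left_distrib scaleR_left_diff_distrib)
  then show ?thesis using * by (simp add: distrib_right)
qed

text \<open>Equality in the triangle inequality, for \<open>b + (- a)\<close> or for
  \<open>(b - a) + a\<close>, would force collinearity with the origin.\<close>

lemma norm_diff_noncollinear:
  fixes a b :: complex
  assumes "\<not> collinear {a, b, 0}"
  shows "cmod b - cmod a < cmod (b - a)" and "cmod (b - a) < cmod b + cmod a"
proof -
  have nc: "\<not> collinear {0, a, b}"
    using assms by (simp add: insert_commute)
  have "cmod (b - a) \<noteq> cmod b + cmod a"
  proof
    assume "cmod (b - a) = cmod b + cmod a"
    then have "collinear {0, b, - a}"
      using norm_triangle_eq_imp_collinear[of b "- a"] by simp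
    then have "collinear {0, - a, b}" by (simp add: insert_commute)
    with nc show False by (auto simp: collinear_iff_Reals)
  qed
  then show "cmod (b - a) < cmod b + cmod a"
    using norm_triangle_ineq4[of b a] by linarith
  have "cmod b - cmod a \<noteq> cmod (b - a)"
  proof
    assume "cmod b - cmod a = cmod (b - a)"
    then have "collinear {0, b - a, a}"
      using norm_triangle_eq_imp_collinear[of "b - a" a] by simp
    then have "collinear {0, a, b - a}" by (simp add: insert_commute)
    \<comment> \<open>Collinearity with 0 means a real quotient, and this number is
      \<open>b / a\<close> when \<open>a\<close> is nonzero. For \<open>a = 0\<close> the quotient
      \<open>b / a\<close> is 0, again contradicting \<open>nc\<close>.\<close>
    then have "(b - a) / a + 1 \<in> \<real>"
      by (intro Reals_add) (simp_all add: collinear_iff_Reals)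
    with nc show False
      by (cases "a = 0") (auto simp: collinear_iff_Reals diff_divide_distrib)
  qed
  then show "cmod b - cmod a < cmod (b - a)"
    using norm_triangle_ineq2[of b a] by linarith
qed

section \<open>The three assertions for a pair of matrices\<close>

text \<open>Common core of the polynomial and matrix versions. The roots for \<open>C1\<close>
  decrease to no less than \<open>cmod b\<close> in the limit, while the inverted roots for
  \<open>C2\<close> approach \<open>cmod a\<close> from below; these two limits are independent, so
  the sizes \<open>n\<close> and \<open>m\<close> may differ.\<close>

lemma annulus_bounds:
  assumes N1: "matrix_norm n N1" and C1: "C1 \<in> carrier_mat n n" and b: "largest_eigenvalue C1 b"
    and N2: "matrix_norm m N2" and C2: "C2 \<in> carrier_mat m m" and a: "largest_eigenvalue C2 (1 / a)"
    and nz: "a \<noteq> 0" and le: "cmod a \<le> cmod b"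
  shows "same_ray_bound N1 C1 N2 C2 a b \<and> opposite_rays_bound N1 C1 N2 C2 a b \<and>
    noncollinear_bounds N1 C1 N2 C2 a b"
proof -
  let ?x = "\<lambda>k. N1 (C1 ^\<^sub>m k) powr (1 / real k)"
  let ?y = "\<lambda>k. N2 (C2 ^\<^sub>m k) powr (- 1 / real k)"
  have b_nz: "b \<noteq> 0" using nz le by auto
  have y_eq: "?y k = inverse (N2 (C2 ^\<^sub>m k) powr (1 / real k))" for k
    by (simp flip: powr_minus)
  have x: "?x \<longlonglongrightarrow> cmod b"
    by (rule root_matrix_norm_tendsto[OF N1 C1 b b_nz])
  have "(\<lambda>k. N2 (C2 ^\<^sub>m k) powr (1 / real k)) \<longlonglongrightarrow> cmod (1 / a)"
    using nz by (intro root_matrix_norm_tendsto[OF N2 C2 a]) simp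
  \<comment> \<open>The limit \<open>cmod (1 / a)\<close> is nonzero, so inversion is continuous
    there.\<close>
  then have "?y \<longlonglongrightarrow> inverse (cmod (1 / a))"
    unfolding y_eq using nz by (intro tendsto_inverse) auto
  then have y: "?y \<longlonglongrightarrow> cmod a" by (simp add: norm_divide)
  have ge_x: "cmod b \<le> ?x k" if "0 < k" for k
    using eigenvalue_norm_le_root_matrix_norm[OF N1 C1 _ b_nz that] b
    by (simp add: largest_eigenvalue_def)
  have y_le: "?y k \<le> cmod a" if "0 < k" for k
  proof -
    have "cmod (1 / a) \<le> N2 (C2 ^\<^sub>m k) powr (1 / real k)"
      using eigenvalue_norm_le_root_matrix_norm[OF N2 C2 _ _ that] a nz
      by (simp add: largest_eigenvalue_def)
    then have "?y k \<le> inverse (cmod (1 / a))"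
      unfolding y_eq using nz by (intro le_imp_inverse_le) auto
    then show ?thesis by (simp add: norm_divide)
  qed
  have "same_ray_bound N1 C1 N2 C2 a b"
    unfolding same_ray_bound_def
  proof (intro impI allI)
    fix k1 k2 :: nat assume "on_same_ray a b" "0 < k1" "0 < k2"
    then show "cmod (b - a) \<le> ?x k1 - ?y k2"
      using norm_diff_same_ray[of a b] le ge_x[of k1] y_le[of k2] by linarith
  qed
  moreover have "opposite_rays_bound N1 C1 N2 C2 a b"
    unfolding opposite_rays_bound_def
  proof (intro impI allI)
    fix e :: real
    assume "collinear {a, b, 0} \<and> on_opposite_rays a b" and "0 < e"
    then have "cmod b + cmod a < cmod (b - a) + e"
      using norm_diff_opposite_rays[of a b] by simp
    then have "\<forall>\<^sub>F k in sequentially. ?x k + ?y k < cmod (b - a) + e"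
      using order_tendstoD(2)[OF tendsto_add[OF x y]] by blast
    then obtain K where "\<forall>k\<ge>K. ?x k + ?y k < cmod (b - a) + e"
      by (auto simp: eventually_sequentially)
    \<comment> \<open>\<open>Suc K\<close> rather than \<open>K\<close> because the threshold
      \<open>k0\<close> has to be positive.\<close>
    then have "\<forall>k>Suc K. cmod (b - a) > ?x k + ?y k - e"
      by (auto simp: algebra_simps)
    then show "\<exists>k0>0. \<forall>k>k0. cmod (b - a) > ?x k + ?y k - e"
      by blast
  qed
  moreover have "noncollinear_bounds N1 C1 N2 C2 a b"
    unfolding noncollinear_bounds_def
  proof (intro impI)
    \<comment> \<open>The witnesses for \<open>\<gamma>1\<close> and \<open>\<gamma>2\<close> are
      the gaps in the two strict triangle inequalities; anything smaller leaves the limits strictly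
      on the right side.\<close>
    let ?g1 = "cmod (b - a) - (cmod b - cmod a)" and ?g2 = "cmod b + cmod a - cmod (b - a)"
    assume nc: "\<not> collinear {a, b, 0}"
    have "\<exists>k0. \<forall>k>k0. ?x k - ?y k + e1 < cmod (b - a) \<and> cmod (b - a) < ?x k + ?y k - e2"
      if e: "e1 \<in> {0..<?g1}" "e2 \<in> {0..<?g2}" for e1 e2
    proof -
      have "\<forall>\<^sub>F k in sequentially. ?x k - ?y k < cmod (b - a) - e1"
        using e by (intro order_tendstoD(2)[OF tendsto_diff[OF x y]]) auto
      moreover have "\<forall>\<^sub>F k in sequentially. cmod (b - a) + e2 < ?x k + ?y k"
        using e by (intro order_tendstoD(1)[OF tendsto_add[OF x y]]) auto
      ultimately have "\<forall>\<^sub>F k in sequentially.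
          ?x k - ?y k + e1 < cmod (b - a) \<and> cmod (b - a) < ?x k + ?y k - e2"
        by eventually_elim linarith
      then show ?thesis by (auto simp: eventually_sequentially intro: less_imp_le)
    qed
    moreover have "0 < ?g1" "0 < ?g2" using norm_diff_noncollinear[OF nc] by simp_all
    ultimately show "\<exists>\<gamma>1>0. \<exists>\<gamma>2>0. \<forall>\<epsilon>1\<in>{0..<\<gamma>1}. \<forall>\<epsilon>2\<in>{0..<\<gamma>2}. \<exists>k0. \<forall>k>k0.
        ?x k - ?y k + \<epsilon>1 < cmod (b - a) \<and> cmod (b - a) < ?x k + ?y k - \<epsilon>2"
      by blast
  qed
  ultimately show ?thesis by blast
qed

section \<open>Ordered roots and eigenvalues of companion matrices\<close>

lemma ordered_roots_image:
  assumes "ordered_roots p n l" "p \<noteq> 0"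
  shows "l ` {1..n} = {x. poly p x = 0}"
proof -
  have "set_mset (image_mset l (mset_set {1..n})) = set_mset (proots p)"
    using assms(1) by (simp add: ordered_roots_def)
  then show ?thesis using assms(2) by simp
qed

lemma ordered_roots_extremes:
  assumes l: "ordered_roots p n l" and p: "p \<noteq> 0" and n: "0 < n"
  shows "poly p (l 1) = 0" "poly p (l n) = 0"
    and "poly p x = 0 \<Longrightarrow> cmod (l 1) \<le> cmod x \<and> cmod x \<le> cmod (l n)"
proof -
  note roots = ordered_roots_image[OF l p]
  show "poly p (l 1) = 0" "poly p (l n) = 0"
    using roots n by auto
  assume "poly p x = 0"
  then have "x \<in> l ` {1..n}" using roots by simp
  then obtain i where "i \<in> {1..n}" "x = l i" by blast
  then show "cmod (l 1) \<le> cmod x \<and> cmod x \<le> cmod (l n)"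
    using l by (auto simp: ordered_roots_def modulus_ordered_def)
qed

text \<open>The rows of the equation \<open>transpose C * v = x * v\<close> read \<open>v (j + 1) = x * v j\<close>, so the
  left eigenvectors of the companion matrix are the multiples of \<open>(1, x, ..., x ^ (n - 1))\<close>.\<close>

lemma eigenvalue_companion_mat:
  assumes monic: "lead_coeff f = 1" and deg: "0 < degree f"
  shows "eigenvalue (companion_mat f) x \<longleftrightarrow> poly f x = 0"
proof -
  define n where "n = degree f"
  let ?C = "companion_mat f"
  have C: "?C \<in> carrier_mat n n" by (simp add: companion_mat_def n_def)
  have n: "0 < n" using deg by (simp add: n_def)
  have poly_f: "poly f x = x ^ n + (\<Sum>i<n. coeff f i * x ^ i)"
    using monic by (simp add: poly_altdef n_def lessThan_Suc_atMost[symmetric])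
  have entry: "(transpose_mat ?C *\<^sub>v v) $ j = 
      (if j = n - 1 then - (\<Sum>i<n. coeff f i * v $ i) else v $ Suc j)"
    if v: "v \<in> carrier_vec n" and j: "j < n" for v j
  proof -
    have "(transpose_mat ?C *\<^sub>v v) $ j = (\<Sum>i<n. ?C $$ (i, j) * v $ i)"
      using v j C by (auto simp: scalar_prod_def atLeast0LessThan intro!: sum.cong)
    also have "\<dots> = (\<Sum>i<n. (if j = n - 1 then - coeff f i else if i = Suc j then 1 else 0) * v $ i)"
      using j by (intro sum.cong) (auto simp: companion_mat_def n_def)
    also have "\<dots> = (if j = n - 1 then - (\<Sum>i<n. coeff f i * v $ i) else v $ Suc j)"
    proof (cases "j = n - 1")
      case True
      then show ?thesis by (simp add: sum_negf)
    next
      case False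
      then have "Suc j < n" using j by simp
      have "(\<Sum>i<n. (if i = Suc j then 1 else 0) * v $ i) = (\<Sum>i<n. if i = Suc j then v $ i else 0)"
        by (intro sum.cong) auto
      then show ?thesis using False \<open>Suc j < n\<close> by simp
    qed
    finally show ?thesis .
  qed
  \<comment> \<open>A matrix and its transpose have the same characteristic polynomial, so left
    eigenvectors suffice.\<close>
  have "eigenvalue ?C x \<longleftrightarrow> eigenvalue (transpose_mat ?C) x"
    using C eigenvalue_root_char_poly[of ?C n] eigenvalue_root_char_poly[of "transpose_mat ?C" n]
    by simp
  also have "\<dots> \<longleftrightarrow> poly f x = 0"
  proof
    assume "eigenvalue (transpose_mat ?C) x"
    then obtain v where v: "v \<in> carrier_vec n" "v \<noteq> 0\<^sub>v n" "transpose_mat ?C *\<^sub>v v = x \<cdot>\<^sub>v v"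
      using C by (auto simp: eigenvalue_def eigenvector_def)
    have eq: "x * v $ j = (if j = n - 1 then - (\<Sum>i<n. coeff f i * v $ i) else v $ Suc j)"
      if "j < n" for j
      using entry[OF v(1) that] v(1,3) that by simp
    \<comment> \<open>All rows but the last determine \<open>v\<close> from its entry 0, which
      therefore cannot vanish; the last row then becomes
      \<open>poly f x * v $ 0 = 0\<close>.\<close>
    have v_pow: "v $ j = x ^ j * v $ 0" if "j < n" for j
      using that
    proof (induction j)
      case (Suc j)
      then show ?case using eq[of j] by (simp add: mult.assoc)
    qed simp
    have v0: "v $ 0 \<noteq> 0"
    proof
      assume "v $ 0 = 0"
      then have "v = 0\<^sub>v n" using v(1) v_pow by (intro eq_vecI) auto
      with v(2) show False by simp
    qed
    have "(\<Sum>i<n. coeff f i * v $ i) = (\<Sum>i<n. coeff f i * x ^ i) * v $ 0"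
      unfolding sum_distrib_right
      by (rule sum.cong[OF refl], subst v_pow) (simp_all only: lessThan_iff mult.assoc)
    moreover have "x * v $ (n - 1) = x ^ n * v $ 0"
      using v_pow[of "n - 1"] n by (simp flip: power_Suc mult.assoc)
    ultimately have "poly f x * v $ 0 = 0"
      using eq[of "n - 1"] n by (simp add: poly_f distrib_right)
    then show "poly f x = 0" using v0 by simp
  next
    assume root: "poly f x = 0"
    define v where "v = vec n (\<lambda>i. x ^ i)"
    have v: "v \<in> carrier_vec n" by (simp add: v_def)
    \<comment> \<open>The entry is \<open>x ^ 0 = 1\<close>, also for \<open>x = 0\<close>.\<close>
    have "v $ 0 \<noteq> 0\<^sub>v n $ 0" using n by (simp add: v_def)
    then have "v \<noteq> 0\<^sub>v n" by auto
    moreover have "transpose_mat ?C *\<^sub>v v = x \<cdot>\<^sub>v v"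
    proof (rule eq_vecI)
      fix j assume "j < dim_vec (x \<cdot>\<^sub>v v)"
      then have j: "j < n" by (simp add: v_def)
      have "- (\<Sum>i<n. coeff f i * x ^ i) = x * x ^ (n - 1)"
        using root n by (simp add: poly_f add_eq_0_iff flip: power_Suc)
      then show "(transpose_mat ?C *\<^sub>v v) $ j = (x \<cdot>\<^sub>v v) $ j"
        using entry[OF v j] j by (auto simp: v_def)
    qed (use C v in auto)
    ultimately show "eigenvalue (transpose_mat ?C) x"
      using C v by (auto simp: eigenvalue_def eigenvector_def)
  qed
  finally show ?thesis .
qed

section \<open>Reciprocal roots and eigenvalues\<close>

text \<open>For nonzero \<open>x\<close> the reflected polynomial takes the value
  \<open>x ^ degree p * poly p (inverse x)\<close>; at 0 it takes the leading coefficient of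
  \<open>p\<close>, which is nonzero.\<close>

lemma poly_monic_reversal_eq_0_iff:
  assumes "p \<noteq> 0" "coeff p 0 \<noteq> 0"
  shows "poly (monic_reversal p) x = 0 \<longleftrightarrow> x \<noteq> 0 \<and> poly p (inverse x) = 0"
  using assms by (cases "x = 0") (auto simp: monic_reversal_def poly_reflect_poly_nz)

text \<open>Applying \<open>B\<close> to \<open>A v = \<mu> v\<close> gives
  \<open>v = \<mu> (B v)\<close>, which rules out \<open>\<mu> = 0\<close> and exhibits the same
  \<open>v\<close> as an eigenvector of \<open>B\<close>.\<close>

lemma eigenvalue_inverse_mat:
  fixes A :: "'a :: field mat"
  assumes A: "A \<in> carrier_mat n n" and B: "B \<in> carrier_mat n n" and BA: "B * A = 1\<^sub>m n"
    and ev: "eigenvalue A \<mu>"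
  shows "\<mu> \<noteq> 0 \<and> eigenvalue B (inverse \<mu>)"
proof -
  obtain v where v: "v \<in> carrier_vec n" "v \<noteq> 0\<^sub>v n" "A *\<^sub>v v = \<mu> \<cdot>\<^sub>v v"
    using ev A by (auto simp: eigenvalue_def eigenvector_def)
  have "v = (B * A) *\<^sub>v v" using v by (simp add: BA)
  also have "\<dots> = B *\<^sub>v (\<mu> \<cdot>\<^sub>v v)" using A B v by (simp add: assoc_mult_mat_vec[of _ n n _ n])
  also have "\<dots> = \<mu> \<cdot>\<^sub>v (B *\<^sub>v v)" using B v by (simp add: mult_mat_vec)
  finally have eq: "v = \<mu> \<cdot>\<^sub>v (B *\<^sub>v v)" .
  have nz: "\<mu> \<noteq> 0"
  proof
    assume "\<mu> = 0"
    then have "v = 0\<^sub>v n" using B by (subst eq) auto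
    with v(2) show False by simp
  qed
  have "inverse \<mu> \<cdot>\<^sub>v v = B *\<^sub>v v"
    using nz by (subst eq) (simp add: smult_smult_assoc)
  then show ?thesis
    using nz v B by (auto simp: eigenvalue_def eigenvector_def)
qed

text \<open>Inversion reverses the order of moduli. The predicate \<open>P\<close> stands for being
  a root of \<open>p\<close> or an eigenvalue of \<open>C\<close>, so one argument serves both
  versions.\<close>

lemma largest_eigenvalue_reciprocal:
  assumes "\<And>\<nu>. eigenvalue B \<nu> \<longleftrightarrow> \<nu> \<noteq> 0 \<and> P (inverse \<nu>)"
    and "P a" "a \<noteq> 0" "\<And>\<mu>. P \<mu> \<Longrightarrow> cmod a \<le> cmod \<mu>"
  shows "largest_eigenvalue B (1 / a)"
  unfolding largest_eigenvalue_def
proof (intro conjI allI impI)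
  show "eigenvalue B (1 / a)" using assms by simp
  fix \<nu> assume "eigenvalue B \<nu>"
  then have "\<nu> \<noteq> 0" "cmod a \<le> inverse (cmod \<nu>)"
    using assms by (auto simp flip: norm_inverse)
  then show "cmod \<nu> \<le> cmod (1 / a)"
    using \<open>a \<noteq> 0\<close> by (simp add: norm_divide field_simps)
qed

section \<open>Hypotheses of \<open>annulus_bounds\<close> in the two settings\<close>

lemma companion_bounds:
  assumes p: "lead_coeff p = 1" "0 < degree p" "coeff p 0 \<noteq> 0"
    and l: "ordered_roots p (degree p) l"
  shows "largest_eigenvalue (companion_mat p) (l (degree p))"
    and "largest_eigenvalue (companion_mat (monic_reversal p)) (1 / l 1)"
    and "l 1 \<noteq> 0" and "cmod (l 1) \<le> cmod (l (degree p))"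
proof -
  have "p \<noteq> 0" using p by auto
  note ext = ordered_roots_extremes[OF l this p(2)]
  show nz: "l 1 \<noteq> 0" using ext(1) p(3) by (auto simp: poly_0_coeff_0)
  show "cmod (l 1) \<le> cmod (l (degree p))" using ext by blast
  show "largest_eigenvalue (companion_mat p) (l (degree p))"
    using ext by (auto simp: largest_eigenvalue_def eigenvalue_companion_mat[OF p(1,2)])
  \<comment> \<open>The degree is preserved, so the leading coefficient is
    \<open>coeff p 0 / coeff p 0\<close>.\<close>
  have "lead_coeff (monic_reversal p) = 1" "0 < degree (monic_reversal p)"
    using p by (simp_all add: degree_monic_reversal coeff_monic_reversal)
  then show "largest_eigenvalue (companion_mat (monic_reversal p)) (1 / l 1)"
    using ext nz \<open>p \<noteq> 0\<close> p(3)
    by (intro largest_eigenvalue_reciprocal[where P = "\<lambda>x. poly p x = 0"])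
      (auto simp: eigenvalue_companion_mat poly_monic_reversal_eq_0_iff)
qed

lemma invertible_bounds:
  assumes n: "0 < n" and C: "C \<in> carrier_mat n n" and inv: "invertible_mat C"
    and l: "ordered_roots (char_poly C) n l"
  shows "largest_eigenvalue C (l n)"
    and "\<lbrakk>D \<in> carrier_mat n n; inverts_mat C D; inverts_mat D C\<rbrakk> \<Longrightarrow> largest_eigenvalue D (1 / l 1)"
    and "l 1 \<noteq> 0" and "cmod (l 1) \<le> cmod (l n)"
proof -
  have "char_poly C \<noteq> 0" using degree_monic_char_poly[OF C] by auto
  \<comment> \<open>Folding turns roots of the characteristic polynomial into eigenvalues of
    \<open>C\<close>.\<close>
  note ext = ordered_roots_extremes[OF l this n, folded eigenvalue_root_char_poly[OF C]]
  obtain E where E: "C * E = 1\<^sub>m n" "E * C = 1\<^sub>m (dim_row E)"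
    using inv C by (auto simp: invertible_mat_def inverts_mat_def)
  \<comment> \<open>Invertibility does not state the size of \<open>E\<close>; it follows by
    comparing column counts in both products.\<close>
  have "dim_row E = n" "dim_col E = n"
    using arg_cong[OF E(1), of dim_col] arg_cong[OF E(2), of dim_col] C by auto
  then have "E \<in> carrier_mat n n" "E * C = 1\<^sub>m n" using E by auto
  then show nz: "l 1 \<noteq> 0" using eigenvalue_inverse_mat[OF C] ext(1) by blast
  show "cmod (l 1) \<le> cmod (l n)" using ext by blast
  show "largest_eigenvalue C (l n)" using ext by (auto simp: largest_eigenvalue_def)
  assume D: "D \<in> carrier_mat n n" and "inverts_mat C D" "inverts_mat D C"
  then have CD: "C * D = 1\<^sub>m n" and DC: "D * C = 1\<^sub>m n"
    using C by (auto simp: inverts_mat_def)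
  \<comment> \<open>The inverse relation is used in both directions, which makes this an
    equivalence.\<close>
  have "eigenvalue D \<nu> \<longleftrightarrow> \<nu> \<noteq> 0 \<and> eigenvalue C (inverse \<nu>)" for \<nu>
    using eigenvalue_inverse_mat[OF C D DC, of "inverse \<nu>"] eigenvalue_inverse_mat[OF D C CD, of \<nu>]
    by auto
  then show "largest_eigenvalue D (1 / l 1)"
    using ext nz by (intro largest_eigenvalue_reciprocal[where P = "eigenvalue C"]) auto
qed

theorem theorem5p2:
  shows
    "(\<forall>(n::nat) (p::complex poly) (l::nat \<Rightarrow> complex) C1 C2 N1 N2.
        2 \<le> n \<and> degree p = n \<and> lead_coeff p = 1 \<and> coeff p 0 \<noteq> 0 \<and>
        ordered_roots p n l \<and>
        C1 = companion_mat p \<and> C2 = companion_mat (monic_reversal p) \<and>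
        matrix_norm n N1 \<and> matrix_norm n N2 \<longrightarrow>
        same_ray_bound N1 C1 N2 C2 (l 1) (l n) \<and>
        opposite_rays_bound N1 C1 N2 C2 (l 1) (l n) \<and>
        noncollinear_bounds N1 C1 N2 C2 (l 1) (l n)) \<and>
     (\<forall>(n::nat) (m::nat) (l::nat \<Rightarrow> complex) C1 C2 N1 N2.
        2 \<le> n \<and> C1 \<in> carrier_mat n n \<and> invertible_mat C1 \<and>
        ordered_roots (char_poly C1) n l \<and>
        C2 \<in> carrier_mat m m \<and>
        (m = n \<and> inverts_mat C1 C2 \<and> inverts_mat C2 C1 \<or>
         largest_eigenvalue C2 (1 / l 1) \<and> smallest_eigenvalue C2 (1 / l n)) \<and>
        matrix_norm n N1 \<and> matrix_norm m N2 \<longrightarrow>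
        same_ray_bound N1 C1 N2 C2 (l 1) (l n) \<and>
        opposite_rays_bound N1 C1 N2 C2 (l 1) (l n) \<and>
        noncollinear_bounds N1 C1 N2 C2 (l 1) (l n))"
proof (rule conjI; intro allI impI)
  fix n :: nat and p :: "complex poly" and l :: "nat \<Rightarrow> complex" and C1 C2 N1 N2
  assume *: "2 \<le> n \<and> degree p = n \<and> lead_coeff p = 1 \<and> coeff p 0 \<noteq> 0 \<and>
    ordered_roots p n l \<and> C1 = companion_mat p \<and> C2 = companion_mat (monic_reversal p) \<and>
    matrix_norm n N1 \<and> matrix_norm n N2"
  then have "C1 \<in> carrier_mat n n" "C2 \<in> carrier_mat n n"
    by (auto simp: companion_mat_def degree_monic_reversal)
  then show "same_ray_bound N1 C1 N2 C2 (l 1) (l n) \<and>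
      opposite_rays_bound N1 C1 N2 C2 (l 1) (l n) \<and> noncollinear_bounds N1 C1 N2 C2 (l 1) (l n)"
    using * companion_bounds[of p l] by (intro annulus_bounds[of n _ _ _ n]) auto
next
  fix n m :: nat and l :: "nat \<Rightarrow> complex" and C1 C2 N1 N2
  assume *: "2 \<le> n \<and> C1 \<in> carrier_mat n n \<and> invertible_mat C1 \<and>
    ordered_roots (char_poly C1) n l \<and> C2 \<in> carrier_mat m m \<and>
    (m = n \<and> inverts_mat C1 C2 \<and> inverts_mat C2 C1 \<or>
      largest_eigenvalue C2 (1 / l 1) \<and> smallest_eigenvalue C2 (1 / l n)) \<and>
    matrix_norm n N1 \<and> matrix_norm m N2"
  then have "0 < n" by simp
  note bounds = invertible_bounds[OF this, of C1 l]
  have "largest_eigenvalue C2 (1 / l 1)"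
    using * bounds(2) by blast
  then show "same_ray_bound N1 C1 N2 C2 (l 1) (l n) \<and>
      opposite_rays_bound N1 C1 N2 C2 (l 1) (l n) \<and> noncollinear_bounds N1 C1 N2 C2 (l 1) (l n)"
    using * bounds by (intro annulus_bounds[of n _ _ _ m]) auto
qed

end
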